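(* Let $\varphi_1$ and $\varphi_2$ be consistent (satisfiable) Boolean formulas over the finite set of Boolean variables $\Sigma$. Then $\varphi_1$ and $\varphi_2$ are logically equivalent if and only if they have the same set of b-rules; that is, $M(\varphi_1)=M(\varphi_2)$ if and only if $R(\varphi_1)=R(\varphi_2)$.
   Context: $\Sigma=\{X_1,\ldots,X_n\}$ is a fixed finite set of Boolean variables. A literal of variable $X$ is $x$ (positive) or $\bar{x}$ (negative); $\bar{\ell}$ denotes the complement of literal $\ell$. A world $\omega$ is a truth assignment to $\Sigma$, identified with the set of literals (exactly one per variable of $\Sigma$) that it makes true. $M(\varphi)$ is the set of worlds satisfying formula $\varphi$ (its models). For a literal $\ell$ of variable $X$, $\omega[\ell]$ is the world obtained from $\omega$ by replacing its literal of $X$ by $\ell$. A world $\omega$ is an $\ell$-boundary model of $\varphi$ iff $\ell\in\omega$, $\omega\models\varphi$ and $\omega[\bar{\ell}]\models\neg\varphi$. A boundary rule (b-rule) has the form $\alpha\rightarrow\ell$, where $\ell$ is a literal of some variable $X\in\Sigma$ and $\alpha$ is a set containing exactly one literal for each variable in $\Sigma\setminus\{X\}$. Formula $\varphi$ has b-rule $\alpha\rightarrow\ell$ iff the world $\alpha\cup\{\ell\}$ is an $\ell$-boundary model of $\varphi$. $R(\varphi)$ is the set of all b-rules that $\varphi$ has. *)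

theory Defs
  imports Main
begin

datatype 'a literal = Pos 'a | Neg 'a

fun variable_of :: "'a literal \<Rightarrow> 'a" where
  "variable_of (Pos X) = X"
| "variable_of (Neg X) = X"

fun complement :: "'a literal \<Rightarrow> 'a literal" where
  "complement (Pos X) = Neg X"
| "complement (Neg X) = Pos X"

datatype (vars: 'a) formula =
    Atom 'a
  | Verum
  | Falsum
  | Negation "'a formula"
  | Conj "'a formula" "'a formula"
  | Disj "'a formula" "'a formula"
  | Implies "'a formula" "'a formula"
  | Equiv "'a formula" "'a formula"

definition literal_choices :: "'a set \<Rightarrow> 'a literal set set" where
  "literal_choices V =
    {\<alpha>. variable_of ` \<alpha> \<subseteq> V \<and> (\<forall>X\<in>V. \<exists>!l. l \<in> \<alpha> \<and> variable_of l = X)}"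

definition worlds :: "'a set \<Rightarrow> 'a literal set set" where
  "worlds \<Sigma> = literal_choices \<Sigma>"

text \<open>
  A world is the set of literals it makes true. Satisfaction is intended only for worlds
  over a set of variables that contains all variables of the formula; there, an atom is
  false exactly if its negative literal belongs to the world.
\<close>

fun sat :: "'a literal set \<Rightarrow> 'a formula \<Rightarrow> bool" (infix "\<Turnstile>" 50) where
  "\<omega> \<Turnstile> Atom X \<longleftrightarrow> Pos X \<in> \<omega>"
| "\<omega> \<Turnstile> Verum \<longleftrightarrow> True"
| "\<omega> \<Turnstile> Falsum \<longleftrightarrow> False"
| "\<omega> \<Turnstile> Negation \<phi> \<longleftrightarrow> \<not> \<omega> \<Turnstile> \<phi>"
| "\<omega> \<Turnstile> Conj \<phi> \<psi> \<longleftrightarrow> \<omega> \<Turnstile> \<phi> \<and> \<omega> \<Turnstile> \<psi>"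
| "\<omega> \<Turnstile> Disj \<phi> \<psi> \<longleftrightarrow> \<omega> \<Turnstile> \<phi> \<or> \<omega> \<Turnstile> \<psi>"
| "\<omega> \<Turnstile> Implies \<phi> \<psi> \<longleftrightarrow> (\<omega> \<Turnstile> \<phi> \<longrightarrow> \<omega> \<Turnstile> \<psi>)"
| "\<omega> \<Turnstile> Equiv \<phi> \<psi> \<longleftrightarrow> (\<omega> \<Turnstile> \<phi> \<longleftrightarrow> \<omega> \<Turnstile> \<psi>)"

definition models :: "'a set \<Rightarrow> 'a formula \<Rightarrow> 'a literal set set" where
  "models \<Sigma> \<phi> = {\<omega> \<in> worlds \<Sigma>. \<omega> \<Turnstile> \<phi>}"

definition consistent :: "'a set \<Rightarrow> 'a formula \<Rightarrow> bool" where
  "consistent \<Sigma> \<phi> \<longleftrightarrow> (\<exists>\<omega> \<in> worlds \<Sigma>. \<omega> \<Turnstile> \<phi>)"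

definition set_literal :: "'a literal set \<Rightarrow> 'a literal \<Rightarrow> 'a literal set" where
  "set_literal \<omega> l = insert l {m \<in> \<omega>. variable_of m \<noteq> variable_of l}"

definition boundary_model :: "'a set \<Rightarrow> 'a literal \<Rightarrow> 'a formula \<Rightarrow> 'a literal set \<Rightarrow> bool" where
  "boundary_model \<Sigma> l \<phi> \<omega> \<longleftrightarrow>
    \<omega> \<in> worlds \<Sigma> \<and> l \<in> \<omega> \<and> \<omega> \<Turnstile> \<phi> \<and> set_literal \<omega> (complement l) \<Turnstile> Negation \<phi>"

datatype 'a brule = BRule (body: "'a literal set") (head: "'a literal")

definition is_brule :: "'a set \<Rightarrow> 'a brule \<Rightarrow> bool" where
  "is_brule \<Sigma> r \<longleftrightarrow>
    variable_of (head r) \<in> \<Sigma> \<and> body r \<in> literal_choices (\<Sigma> - {variable_of (head r)})"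

definition has_brule :: "'a set \<Rightarrow> 'a formula \<Rightarrow> 'a brule \<Rightarrow> bool" where
  "has_brule \<Sigma> \<phi> r \<longleftrightarrow> boundary_model \<Sigma> (head r) \<phi> (body r \<union> {head r})"

definition brules :: "'a set \<Rightarrow> 'a formula \<Rightarrow> 'a brule set" where
  "brules \<Sigma> \<phi> = {r. is_brule \<Sigma> r \<and> has_brule \<Sigma> \<phi> r}"

end

theory Submission
  imports Defs
begin

text \<open>
  The b-rules of a formula record the edges of the hypercube of worlds along which its truth
  value changes, together with the direction of the change. If two formulas have the same
  b-rules, then every neighbour of a world that satisfies the first but not the second again
  satisfies the first but not the second. The hypercube is connected, so one such world would
  make the second formula inconsistent.
\<close>

lemma variable_of_complement [simp]: "variable_of (complement l) = variable_of l"
  by (cases l) auto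

lemma complement_complement [simp]: "complement (complement l) = l"
  by (cases l) auto

lemma complement_neq [simp]: "complement l \<noteq> l"
  by (cases l) auto

lemma same_variable_iff:
  "variable_of m = variable_of l \<longleftrightarrow> m = l \<or> m = complement l"
  by (cases l; cases m) auto

lemma world_variable_in: "\<omega> \<in> worlds \<Sigma> \<Longrightarrow> l \<in> \<omega> \<Longrightarrow> variable_of l \<in> \<Sigma>"
  by (auto simp: worlds_def literal_choices_def)

lemma world_complement_iff:
  assumes "\<omega> \<in> worlds \<Sigma>" and "variable_of l \<in> \<Sigma>"
  shows "complement l \<in> \<omega> \<longleftrightarrow> l \<notin> \<omega>"
proof -
  have "\<exists>!m. m \<in> \<omega> \<and> variable_of m = variable_of l"
    using assms by (simp add: worlds_def literal_choices_def)
  then have "\<exists>!m. m \<in> \<omega> \<and> (m = l \<or> m = complement l)"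
    by (simp only: same_variable_iff)
  then show ?thesis using complement_neq[of l] by blast
qed

text \<open>Converse of \<open>world_complement_iff\<close>: over \<Sigma>, unique choice of a
  literal per variable amounts to containing exactly one of each complementary pair. Together the
  two facts let later proofs avoid the unique-existence quantifier.\<close>

lemma worldI:
  assumes "variable_of ` \<omega> \<subseteq> \<Sigma>"
    and "\<And>l. variable_of l \<in> \<Sigma> \<Longrightarrow> complement l \<in> \<omega> \<longleftrightarrow> l \<notin> \<omega>"
  shows "\<omega> \<in> worlds \<Sigma>"
proof -
  have "\<exists>!l. l \<in> \<omega> \<and> variable_of l = X" if "X \<in> \<Sigma>" for X
  proof (rule ex1I)
    show "(if Pos X \<in> \<omega> then Pos X else Neg X) \<in> \<omega> \<and>
        variable_of (if Pos X \<in> \<omega> then Pos X else Neg X) = X"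
      using assms(2)[of "Pos X"] that by simp
    show "l = (if Pos X \<in> \<omega> then Pos X else Neg X)" if "l \<in> \<omega> \<and> variable_of l = X" for l
      using assms(2)[of "Pos X"] that \<open>X \<in> \<Sigma>\<close> by (cases l) auto
  qed
  with assms(1) show ?thesis by (simp add: worlds_def literal_choices_def)
qed

lemma finite_world:
  assumes "finite \<Sigma>" and "\<omega> \<in> worlds \<Sigma>"
  shows "finite \<omega>"
proof (rule finite_subset)
  show "\<omega> \<subseteq> Pos ` \<Sigma> \<union> Neg ` \<Sigma>"
  proof
    fix l assume "l \<in> \<omega>"
    with world_variable_in[OF assms(2) this] show "l \<in> Pos ` \<Sigma> \<union> Neg ` \<Sigma>"
      by (cases l) auto
  qed
  show "finite (Pos ` \<Sigma> \<union> Neg ` \<Sigma>)" using assms(1) by simp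
qed

text \<open>A literal of \<omega> missing from \<omega>' would put its complement into \<omega>',
  hence into \<omega>, which cannot contain both.\<close>

lemma world_subset_eq:
  assumes "\<omega> \<in> worlds \<Sigma>" and "\<omega>' \<in> worlds \<Sigma>" and "\<omega>' \<subseteq> \<omega>"
  shows "\<omega>' = \<omega>"
proof
  show "\<omega> \<subseteq> \<omega>'"
  proof
    fix l assume l: "l \<in> \<omega>"
    note X = world_variable_in[OF assms(1) l]
    show "l \<in> \<omega>'"
      using l assms(3) world_complement_iff[OF assms(1) X] world_complement_iff[OF assms(2) X] by auto
  qed
qed (fact assms(3))

lemma in_set_literal_iff:
  "m \<in> set_literal \<omega> l \<longleftrightarrow> m = l \<or> m \<in> \<omega> \<and> m \<noteq> complement l"
  by (auto simp: set_literal_def same_variable_iff)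

lemma set_literal_world:
  assumes "\<omega> \<in> worlds \<Sigma>" and "variable_of l \<in> \<Sigma>"
  shows "set_literal \<omega> l \<in> worlds \<Sigma>"
proof (rule worldI)
  show "variable_of ` set_literal \<omega> l \<subseteq> \<Sigma>"
    using assms(2) world_variable_in[OF assms(1)] by (auto simp: set_literal_def)
  show "complement m \<in> set_literal \<omega> l \<longleftrightarrow> m \<notin> set_literal \<omega> l" if "variable_of m \<in> \<Sigma>" for m
    using world_complement_iff[OF assms(1) that] unfolding in_set_literal_iff
    by (metis complement_complement complement_neq)
qed

lemma set_literal_flip_back:
  assumes "\<omega> \<in> worlds \<Sigma>" and "l \<in> \<omega>"
  shows "set_literal (set_literal \<omega> (complement l)) l = \<omega>"
  using assms world_complement_iff[OF assms(1) world_variable_in[OF assms]]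
  by (auto simp: in_set_literal_iff)

text \<open>Connectedness of the hypercube as an induction rule: a property preserved by every
  single flip spreads from one world to all. The measure \<open>card (\<omega>' - \<omega>)\<close>
  is the Hamming distance, since each variable on which the worlds disagree contributes exactly one
  literal of \<omega>'.\<close>

lemma worlds_flip_induct:
  assumes fin: "finite \<Sigma>" and "\<omega>' \<in> worlds \<Sigma>" and "\<omega> \<in> worlds \<Sigma>" and "P \<omega>"
    and flip: "\<And>u l. u \<in> worlds \<Sigma> \<Longrightarrow> P u \<Longrightarrow> l \<in> u \<Longrightarrow> P (set_literal u (complement l))"
  shows "P \<omega>'"
  using assms(3,4)
proof (induction "card (\<omega>' - \<omega>)" arbitrary: \<omega> rule: less_induct)
  case less
  show ?case
  proof (cases "\<omega>' \<subseteq> \<omega>")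
    case True
    then show ?thesis using world_subset_eq less.prems assms(2) by metis
  next
    case False
    then obtain l where l: "l \<in> \<omega>'" "l \<notin> \<omega>" by blast
    note X = world_variable_in[OF assms(2) l(1)]
    have c: "complement l \<in> \<omega>" "complement l \<notin> \<omega>'"
      using world_complement_iff[OF less.prems(1) X] world_complement_iff[OF assms(2) X] l by auto
    \<comment> \<open>The literal flipped in \<omega> is \<open>complement l\<close>, so the flip
      installs the literal \<open>l\<close> of the target.\<close>
    have "P (set_literal \<omega> l)"
      using flip[OF less.prems c(1)] by simp
    \<comment> \<open>Losing \<open>complement l\<close> does not enlarge the difference, because
      \<omega>' does not contain it; only \<open>l\<close> leaves the difference.\<close>
    moreover have "\<omega>' - set_literal \<omega> l = (\<omega>' - \<omega>) - {l}"
      using c(2) unfolding set_eq_iff Diff_iff in_set_literal_iff by blast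
    then have "\<omega>' - set_literal \<omega> l \<subset> \<omega>' - \<omega>"
      using l by blast
    then have "card (\<omega>' - set_literal \<omega> l) < card (\<omega>' - \<omega>)"
      using finite_world[OF fin assms(2)] by (intro psubset_card_mono) auto
    ultimately show ?thesis
      using less.hyps set_literal_world[OF less.prems(1) X] by blast
  qed
qed

lemma is_brule_of_world:
  assumes "\<omega> \<in> worlds \<Sigma>" and "l \<in> \<omega>"
  shows "is_brule \<Sigma> (BRule (\<omega> - {l}) l)"
proof -
  note X = world_variable_in[OF assms]
  have c: "complement l \<notin> \<omega>" using world_complement_iff[OF assms(1) X] assms(2) by simp
  have "\<omega> - {l} \<in> worlds (\<Sigma> - {variable_of l})"
  proof (rule worldI)
    show "variable_of ` (\<omega> - {l}) \<subseteq> \<Sigma> - {variable_of l}"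
      using c world_variable_in[OF assms(1)] by (auto simp: same_variable_iff)
    show "complement m \<in> \<omega> - {l} \<longleftrightarrow> m \<notin> \<omega> - {l}"
      if "variable_of m \<in> \<Sigma> - {variable_of l}" for m
      using that world_complement_iff[OF assms(1), of m] by auto
  qed
  with X show ?thesis by (simp add: is_brule_def worlds_def)
qed

text \<open>Removing \<open>l\<close> from a world that contains it leaves a legitimate rule body,
  and adding it back restores the world. Thus equal sets of b-rules mean equal boundary
  models.\<close>

lemma boundary_model_iff_brule:
  assumes "\<omega> \<in> worlds \<Sigma>" and "l \<in> \<omega>"
  shows "boundary_model \<Sigma> l \<phi> \<omega> \<longleftrightarrow> BRule (\<omega> - {l}) l \<in> brules \<Sigma> \<phi>"
  using assms(2) is_brule_of_world[OF assms] by (simp add: brules_def has_brule_def insert_absorb)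

text \<open>Since \<open>l\<close> belongs to \<omega>, its variable lies in \<Sigma> and the
  flipped world is again a world, so falsifying \<phi> there is the same as not being a model. Hence
  boundary models, and with them b-rules, depend on \<phi> only through its models.\<close>

lemma boundary_model_models:
  "boundary_model \<Sigma> l \<phi> \<omega> \<longleftrightarrow>
    \<omega> \<in> models \<Sigma> \<phi> \<and> l \<in> \<omega> \<and> set_literal \<omega> (complement l) \<notin> models \<Sigma> \<phi>"
  using set_literal_world[of \<omega> \<Sigma> "complement l"] world_variable_in[of \<omega> \<Sigma> l]
  by (auto simp: boundary_model_def models_def)

text \<open>A model of \<phi> outside the models of \<psi> would pass this property on, flip by
  flip, to a model of \<psi>. Consistency supplies that model: a valid and an inconsistent formula
  both have no b-rules.\<close>

lemma brules_eq_imp_models_subset: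
  assumes fin: "finite \<Sigma>" and cons: "consistent \<Sigma> \<psi>"
    and eq: "brules \<Sigma> \<phi> = brules \<Sigma> \<psi>"
  shows "models \<Sigma> \<phi> \<subseteq> models \<Sigma> \<psi>"
proof
  fix \<omega> assume \<omega>: "\<omega> \<in> models \<Sigma> \<phi>"
  show "\<omega> \<in> models \<Sigma> \<psi>"
  proof (rule ccontr)
    assume n\<omega>: "\<omega> \<notin> models \<Sigma> \<psi>"
    obtain \<omega>' where \<omega>': "\<omega>' \<in> worlds \<Sigma>" "\<omega>' \<in> models \<Sigma> \<psi>"
      using cons by (auto simp: consistent_def models_def)
    have "\<omega>' \<in> models \<Sigma> \<phi> - models \<Sigma> \<psi>"
    proof (rule worlds_flip_induct[OF fin \<omega>'(1), of \<omega>])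
      show "\<omega> \<in> worlds \<Sigma>" using \<omega> by (simp add: models_def)
      show "\<omega> \<in> models \<Sigma> \<phi> - models \<Sigma> \<psi>" using \<omega> n\<omega> by simp
      fix u l
      assume u: "u \<in> worlds \<Sigma>" "u \<in> models \<Sigma> \<phi> - models \<Sigma> \<psi>" "l \<in> u"
      define v where "v = set_literal u (complement l)"
      have v: "v \<in> worlds \<Sigma>" "complement l \<in> v"
        using set_literal_world[OF u(1)] world_variable_in[OF u(1,3)]
        by (auto simp: v_def in_set_literal_iff)
      have same: "boundary_model \<Sigma> k \<phi> w \<longleftrightarrow> boundary_model \<Sigma> k \<psi> w"
        if "w \<in> worlds \<Sigma>" "k \<in> w" for w k
        using eq by (simp add: boundary_model_iff_brule[OF that])
      \<comment> \<open>Otherwise \<open>u\<close> would be an \<open>l\<close>-boundary model of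
        \<phi>, hence of \<psi>, but \<open>u\<close> is not a model of \<psi>.\<close>
      have "v \<in> models \<Sigma> \<phi>"
        using same[OF u(1,3)] u by (auto simp: boundary_model_models v_def)
      moreover have "set_literal v l = u"
        using set_literal_flip_back[OF u(1,3)] by (simp add: v_def)
      \<comment> \<open>The same edge read from its other end: otherwise \<open>v\<close> would be a
        boundary model of \<psi> for \<open>complement l\<close>, hence of \<phi>, although
        \<open>u\<close> is a model of \<phi>.\<close>
      then have "v \<notin> models \<Sigma> \<psi>"
        using same[OF v] u v by (auto simp: boundary_model_models)
      ultimately show "set_literal u (complement l) \<in> models \<Sigma> \<phi> - models \<Sigma> \<psi>"
        by (simp add: v_def)
    qed
    with \<omega>'(2) show False by simp
  qed
qed

theorem theorem1:
  fixes \<Sigma> :: "'a set" and \<phi>\<^sub>1 \<phi>\<^sub>2 :: "'a formula"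
  assumes "finite \<Sigma>"
    and "vars \<phi>\<^sub>1 \<subseteq> \<Sigma>" and "vars \<phi>\<^sub>2 \<subseteq> \<Sigma>"
    and "consistent \<Sigma> \<phi>\<^sub>1" and "consistent \<Sigma> \<phi>\<^sub>2"
  shows "models \<Sigma> \<phi>\<^sub>1 = models \<Sigma> \<phi>\<^sub>2 \<longleftrightarrow> brules \<Sigma> \<phi>\<^sub>1 = brules \<Sigma> \<phi>\<^sub>2"
proof
  assume "models \<Sigma> \<phi>\<^sub>1 = models \<Sigma> \<phi>\<^sub>2"
  then show "brules \<Sigma> \<phi>\<^sub>1 = brules \<Sigma> \<phi>\<^sub>2"
    by (simp add: brules_def has_brule_def boundary_model_models)
next
  assume "brules \<Sigma> \<phi>\<^sub>1 = brules \<Sigma> \<phi>\<^sub>2"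
  \<comment> \<open>Each inclusion uses the consistency of the formula on its right-hand
    side.\<close>
  then show "models \<Sigma> \<phi>\<^sub>1 = models \<Sigma> \<phi>\<^sub>2"
    using brules_eq_imp_models_subset[OF assms(1)] assms(4,5) by (metis subset_antisym)
qed

end
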